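(* Let $\mathbb{F}=\mathbb{R}$ or $\mathbb{F}=\mathbb{C}$, let $m,n,d$ be positive integers, and let $\mathrm{Syl}[\lambda]^{m\times(m+n)}_d\subset\mathbb{F}[\lambda]^{m\times(m+n)}_d$ be the set of polynomial matrices of size $m\times(m+n)$, degree at most $d$, and with full-Sylvester-rank. Then the complement of $\mathrm{Syl}[\lambda]^{m\times(m+n)}_d$ in $\mathbb{F}[\lambda]^{m\times(m+n)}_d$ is a proper algebraic set of $\mathbb{F}[\lambda]^{m\times(m+n)}_d$ and, so, $\mathrm{Syl}[\lambda]^{m\times(m+n)}_d$ is a generic set of $\mathbb{F}[\lambda]^{m\times(m+n)}_d$.
   Context: $\mathbb{F}[\lambda]^{m\times(m+n)}_d$ is the $\mathbb{F}$-vector space of $m\times(m+n)$ polynomial matrices over $\mathbb{F}$ of degree at most $d$. Sylvester matrices: for $M(\lambda)=M_0+M_1\lambda+\cdots+M_d\lambda^d$ with $M_i\in\mathbb{F}^{m\times(m+n)}$ and $k\ge 1$, $S_k\in\mathbb{F}^{(k+d)m\times k(m+n)}$ is the block matrix with $k+d$ block rows and $k$ block columns whose $(i,j)$ block is $M_{i-j}$ if $0\le i-j\le d$ and $0$ otherwise. $M(\lambda)$ has full-Sylvester-rank if $\operatorname{rank}S_k=\min\{(k+d)m,\;k(m+n)\}$ for all $k=1,2,\dots$. Algebraic and generic sets: an algebraic set in $\mathbb{R}^p$ is the set of common zeros of finitely many polynomials in $p$ variables with real coefficients; it is proper if it is not all of $\mathbb{R}^p$. A generic set of $\mathbb{R}^p$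 is a subset whose complement is contained in a proper algebraic set. These notions are transferred to $\mathbb{F}[\lambda]^{m\times(m+n)}_d$ by identifying it with $\mathbb{R}^{(d+1)m(m+n)}$ when $\mathbb{F}=\mathbb{R}$ (list all entries of $M_0,\dots,M_d$), and with $\mathbb{R}^{2(d+1)m(m+n)}$ when $\mathbb{F}=\mathbb{C}$ (list the real and imaginary parts of all entries of $M_0,\dots,M_d$). *)

theory Defs
  imports Complex_Main "HOL-Library.Poly_Mapping" "Jordan_Normal_Form.DL_Rank"
begin

text \<open>A real polynomial is a finitely supported map from monomials to coefficients,
  a monomial being a finitely supported map from variable indices to exponents.
  The space of real \<open>p\<close>-tuples is \<open>carrier_vec p\<close>, and the variables are numbered
  \<open>0, \<dots>, p - 1\<close>.\<close>

type_synonym real_mpoly = "(nat \<Rightarrow>\<^sub>0 nat) \<Rightarrow>\<^sub>0 real"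

definition in_variables :: "nat \<Rightarrow> real_mpoly \<Rightarrow> bool" where
  "in_variables p P \<longleftrightarrow> (\<forall>t \<in> Poly_Mapping.keys P. Poly_Mapping.keys t \<subseteq> {..<p})"

definition mpoly_eval :: "real_mpoly \<Rightarrow> real vec \<Rightarrow> real" where
  "mpoly_eval P x =
     (\<Sum>t \<in> Poly_Mapping.keys P. Poly_Mapping.lookup P t *
        (\<Prod>i \<in> Poly_Mapping.keys t. (x $ i) ^ Poly_Mapping.lookup t i))"

definition algebraic_set :: "nat \<Rightarrow> real vec set \<Rightarrow> bool" where
  "algebraic_set p Z \<longleftrightarrow>
     (\<exists>Q. finite Q \<and> (\<forall>P \<in> Q. in_variables p P) \<and>
          Z = {x \<in> carrier_vec p. \<forall>P \<in> Q. mpoly_eval P x = 0})"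

definition proper_algebraic_set :: "nat \<Rightarrow> real vec set \<Rightarrow> bool" where
  "proper_algebraic_set p Z \<longleftrightarrow> algebraic_set p Z \<and> Z \<noteq> carrier_vec p"

definition generic_set :: "nat \<Rightarrow> real vec set \<Rightarrow> bool" where
  "generic_set p G \<longleftrightarrow>
     G \<subseteq> carrier_vec p \<and> (\<exists>Z. proper_algebraic_set p Z \<and> carrier_vec p - G \<subseteq> Z)"

definition poly_mats :: "nat \<Rightarrow> nat \<Rightarrow> nat \<Rightarrow> 'a::field poly mat set" where
  "poly_mats m n d =
     {M \<in> carrier_mat m (m + n). \<forall>i < m. \<forall>j < m + n. degree (M $$ (i, j)) \<le> d}"

definition coeff_mat :: "'a::field poly mat \<Rightarrow> nat \<Rightarrow> 'a mat" where
  "coeff_mat M l = map_mat (\<lambda>q. coeff q l) M"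

text \<open>Blocks are numbered from \<open>0\<close> here: the scalar entry \<open>(r, c)\<close> lies in block
  \<open>(r div m, c div (m + n))\<close>.\<close>

definition sylvester_mat :: "nat \<Rightarrow> nat \<Rightarrow> nat \<Rightarrow> 'a::field poly mat \<Rightarrow> nat \<Rightarrow> 'a mat" where
  "sylvester_mat m n d M k =
     mat ((k + d) * m) (k * (m + n))
       (\<lambda>(r, c). let i = r div m; j = c div (m + n) in
          if j \<le> i \<and> i - j \<le> d
          then coeff_mat M (i - j) $$ (r mod m, c mod (m + n)) else 0)"

text \<open>The first argument of \<^const>\<open>vec_space.rank\<close> is the number of rows.\<close>

definition full_Sylvester_rank :: "nat \<Rightarrow> nat \<Rightarrow> nat \<Rightarrow> 'a::field poly mat \<Rightarrow> bool" where
  "full_Sylvester_rank m n d M \<longleftrightarrow>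
     (\<forall>k \<ge> 1. vec_space.rank ((k + d) * m) (sylvester_mat m n d M k)
               = min ((k + d) * m) (k * (m + n)))"

definition Syl :: "nat \<Rightarrow> nat \<Rightarrow> nat \<Rightarrow> 'a::field poly mat set" where
  "Syl m n d = {M \<in> poly_mats m n d. full_Sylvester_rank m n d M}"

text \<open>Position \<open>(l * m + i) * (m + n) + j\<close> of the list of coefficients holds the entry
  \<open>(i, j)\<close> of the coefficient of degree \<open>l\<close>.\<close>

definition list_coeff :: "nat \<Rightarrow> nat \<Rightarrow> 'a::field poly mat \<Rightarrow> nat \<Rightarrow> 'a" where
  "list_coeff m n M s =
     coeff_mat M (s div (m + n) div m) $$ (s div (m + n) mod m, s mod (m + n))"

definition real_coords :: "nat \<Rightarrow> nat \<Rightarrow> nat \<Rightarrow> real poly mat \<Rightarrow> real vec" where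
  "real_coords m n d M = vec ((d + 1) * m * (m + n)) (list_coeff m n M)"

text \<open>Real and imaginary parts alternate.\<close>

definition complex_coords :: "nat \<Rightarrow> nat \<Rightarrow> nat \<Rightarrow> complex poly mat \<Rightarrow> real vec" where
  "complex_coords m n d M =
     vec (2 * (d + 1) * m * (m + n))
       (\<lambda>s. if even s then Re (list_coeff m n M (s div 2)) else Im (list_coeff m n M (s div 2)))"

text \<open>Both coordinate maps are bijections, so algebraic and generic sets can be
  transferred along them.\<close>

lemma list_coeff_inj:
  assumes "M \<in> poly_mats m n d" "N \<in> poly_mats m n d"
    and eq: "\<And>s. s < (d + 1) * m * (m + n) \<Longrightarrow> list_coeff m n M s = list_coeff m n N s"
  shows "M = N"
proof (rule eq_matI)
  show "dim_row M = dim_row N" "dim_col M = dim_col N"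
    using assms by (auto simp: poly_mats_def)
  have dims: "M \<in> carrier_mat m (m + n)" "N \<in> carrier_mat m (m + n)"
    using assms by (auto simp: poly_mats_def)
  fix i j assume "i < dim_row N" "j < dim_col N"
  then have ij: "i < m" "j < m + n" using dims by auto
  show "M $$ (i, j) = N $$ (i, j)"
  proof (rule poly_eqI)
    fix l
    show "coeff (M $$ (i, j)) l = coeff (N $$ (i, j)) l"
    proof (cases "l \<le> d")
      case True
      define s where "s = (l * m + i) * (m + n) + j"
      have a: "s div (m + n) = l * m + i" "s mod (m + n) = j"
        using ij by (auto simp: s_def)
      have b: "s div (m + n) div m = l" "s div (m + n) mod m = i"
        unfolding a using ij by auto
      have "l * m + i < (d + 1) * m"
      proof -
        have "l * m \<le> d * m" using True by simp
        then show ?thesis using ij unfolding add_mult_distrib by linarith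
      qed
      then have "(l * m + i + 1) * (m + n) \<le> (d + 1) * m * (m + n)"
        by (intro mult_le_mono1) simp
      then have "s < (d + 1) * m * (m + n)" using ij by (simp add: s_def)
      from eq[OF this] show ?thesis
        unfolding list_coeff_def a b coeff_mat_def using ij dims by auto
    next
      case False
      have "degree (M $$ (i, j)) \<le> d" "degree (N $$ (i, j)) \<le> d"
        using assms(1,2) ij by (auto simp: poly_mats_def)
      then show ?thesis using False by (simp add: coeff_eq_0)
    qed
  qed
qed

lemma list_coeff_surj:
  assumes "m > 0"
  shows "\<exists>M \<in> poly_mats m n d. \<forall>s < (d + 1) * m * (m + n). list_coeff m n M s = f s"
proof -
  define M where "M = mat m (m + n) (\<lambda>(i, j). \<Sum>l\<le>d. monom (f ((l * m + i) * (m + n) + j)) l)"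
  have cf: "coeff (\<Sum>l\<le>d. monom (g l) l) k = (if k \<le> d then g k else 0)" for g :: "nat \<Rightarrow> 'a" and k
    by (auto simp: coeff_sum sum.delta')
  have "M \<in> poly_mats m n d"
    by (auto simp: poly_mats_def M_def cf intro!: degree_le)
  moreover have "list_coeff m n M s = f s" if s: "s < (d + 1) * m * (m + n)" for s
  proof -
    let ?q = "s div (m + n)"
    have "?q < (d + 1) * m" using s by (simp add: less_mult_imp_div_less)
    then have l: "?q div m < d + 1" by (rule less_mult_imp_div_less)
    have i: "?q mod m < m" "s mod (m + n) < m + n" using assms by auto
    have "list_coeff m n M s = f ((?q div m * m + ?q mod m) * (m + n) + s mod (m + n))"
      using i l by (simp add: list_coeff_def coeff_mat_def M_def cf)
    then show ?thesis unfolding div_mult_mod_eq .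
  qed
  ultimately show ?thesis by blast
qed

lemma bij_betw_real_coords:
  assumes "m > 0"
  shows "bij_betw (real_coords m n d) (poly_mats m n d) (carrier_vec ((d + 1) * m * (m + n)))"
proof (rule bij_betwI')
  fix M N :: "real poly mat" assume MN: "M \<in> poly_mats m n d" "N \<in> poly_mats m n d"
  show "(real_coords m n d M = real_coords m n d N) = (M = N)"
    using list_coeff_inj[OF MN] by (auto simp: real_coords_def vec_eq_iff)
next
  fix v :: "real vec" assume v: "v \<in> carrier_vec ((d + 1) * m * (m + n))"
  obtain M where "M \<in> poly_mats m n d"
    "\<forall>s < (d + 1) * m * (m + n). list_coeff m n M s = v $ s"
    using list_coeff_surj[OF assms] by blast
  then show "\<exists>M \<in> poly_mats m n d. v = real_coords m n d M"
    using v by (intro bexI[of _ M]) (auto simp: real_coords_def)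
qed (simp add: real_coords_def)

lemma bij_betw_complex_coords:
  assumes "m > 0"
  shows "bij_betw (complex_coords m n d) (poly_mats m n d)
           (carrier_vec (2 * (d + 1) * m * (m + n)))"
proof (rule bij_betwI')
  fix M N :: "complex poly mat" assume MN: "M \<in> poly_mats m n d" "N \<in> poly_mats m n d"
  show "(complex_coords m n d M = complex_coords m n d N) = (M = N)"
  proof
    assume eq: "complex_coords m n d M = complex_coords m n d N"
    show "M = N"
    proof (rule list_coeff_inj[OF MN])
      fix s assume s: "s < (d + 1) * m * (m + n)"
      then have "2 * s < 2 * (d + 1) * m * (m + n)" "2 * s + 1 < 2 * (d + 1) * m * (m + n)"
        unfolding mult.assoc by linarith+
      then show "list_coeff m n M s = list_coeff m n N s"
        using arg_cong[OF eq, of "\<lambda>v. v $ (2 * s)"] arg_cong[OF eq, of "\<lambda>v. v $ (2 * s + 1)"]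
        by (simp add: complex_coords_def complex_eq_iff del: mult_Suc add_Suc_right)
    qed
  qed simp
next
  fix v :: "real vec" assume v: "v \<in> carrier_vec (2 * (d + 1) * m * (m + n))"
  obtain M where M: "M \<in> poly_mats m n d"
    "\<forall>s < (d + 1) * m * (m + n). list_coeff m n M s = Complex (v $ (2 * s)) (v $ (2 * s + 1))"
    using list_coeff_surj[OF assms, of n d "\<lambda>s. Complex (v $ (2 * s)) (v $ (2 * s + 1))"] by blast
  have "s div 2 < (d + 1) * m * (m + n)" if "s < 2 * (d + 1) * m * (m + n)" for s
    using that unfolding mult.assoc by linarith
  with M v show "\<exists>M \<in> poly_mats m n d. v = complex_coords m n d M"
    by (intro bexI[of _ M] eq_vecI) (auto simp: complex_coords_def odd_pos simp del: mult_Suc)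
qed (simp add: complex_coords_def)

end

(* A matrix has full rank iff the determinant of its Gram matrix, on the smaller side, does not
   vanish; over the reals and the complex numbers this is a polynomial condition on the real
   coordinates.  A left null vector of S_(k+1) restricts to left null vectors of S_k, so full row
   rank at k = d m, where S_k is already wide, implies it for all larger k.  Thus the complement of
   Syl is the zero set of the product of the Gram determinants for k = 1, ..., d m.

   It is proper because a zigzag matrix has full Sylvester rank.  Place the rows as consecutive
   intervals of length d on a line of length d m.  Each inner endpoint gives a column linking two
   neighbouring rows, and the n + 1 points that cut the line into n pieces as equal as integers
   allow give columns with a single nonzero entry.  The Sylvester matrices then split into small
   blocks, one for each position on the line. *)

theory Submission
  imports Defs
begin

section \<open>Full rank and Gram determinants\<close>

context vec_space
begin

text \<open>Linear independence concerns the set of columns and does not see repetitions, so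
  distinctness of the columns is obtained separately in both directions.\<close>

lemma rank_eq_nc_iff_kernel:
  assumes A: "A \<in> carrier_mat n nc"
  shows "rank A = nc \<longleftrightarrow> (\<forall>v \<in> carrier_vec nc. A *\<^sub>v v = 0\<^sub>v n \<longrightarrow> v = 0\<^sub>v nc)"
proof
  assume rk: "rank A = nc"
  obtain S where S: "maximal S (\<lambda>T. T \<subseteq> set (cols A) \<and> lin_indpt T)"
    using maximal_exists[of "\<lambda>T. T \<subseteq> set (cols A) \<and> lin_indpt T" "card (set (cols A))" "{}"]
    by (meson List.finite_set card_mono empty_iff empty_subsetI finite_lin_indpt2 rev_finite_subset)
  then have "card S \<le> card (set (cols A))" by (simp add: card_mono maximal_def)
  then have "length (cols A) \<le> card (set (cols A))"
    using rank_card_indpt[OF A S] rk A by simp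
  then have "distinct (cols A)" using card_length[of "cols A"] by (intro card_distinct) simp
  then show "\<forall>v \<in> carrier_vec nc. A *\<^sub>v v = 0\<^sub>v n \<longrightarrow> v = 0\<^sub>v nc"
    using full_rank_lin_indpt[OF A rk] lin_depI[OF A] by blast
next
  assume ker: "\<forall>v \<in> carrier_vec nc. A *\<^sub>v v = 0\<^sub>v n \<longrightarrow> v = 0\<^sub>v nc"
  have "distinct (cols A)"
  proof (rule ccontr)
    assume "\<not> distinct (cols A)"
    then obtain i j where ij: "i < nc" "j < nc" "i \<noteq> j" "col A i = col A j"
      using A by (auto simp: distinct_conv_nth)
    have unit: "A *\<^sub>v unit_vec nc l = col A l" if "l < nc" for l
      using A that by (intro eq_vecI) auto
    have "A *\<^sub>v (unit_vec nc i - unit_vec nc j) = col A i - col A j"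
      using A ij unit by (simp add: mult_minus_distrib_mat_vec[of _ n nc])
    also have "\<dots> = 0\<^sub>v n" using A ij by auto
    finally have "unit_vec nc i - unit_vec nc j = (0\<^sub>v nc :: 'a vec)" using ker by simp
    then have "(unit_vec nc i - unit_vec nc j :: 'a vec) $ i = 0" using ij by simp
    then show False using ij by simp
  qed
  then show "rank A = nc" using lin_depE[OF A] ker lin_indpt_full_rank[OF A] by blast
qed

text \<open>The range is the span of the columns, and \<open>n\<close> independent columns already
  form a basis of the whole space.\<close>

lemma rank_eq_n_iff_surj:
  assumes A: "A \<in> carrier_mat n nc"
  shows "rank A = n \<longleftrightarrow> (\<forall>y \<in> carrier_vec n. \<exists>x \<in> carrier_vec nc. A *\<^sub>v x = y)"
proof -
  have cA: "set (cols A) \<subseteq> carrier_vec n" using A cols_dim by blast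
  have sub: "span (set (cols A)) \<subseteq> carrier_vec n" using cA by (simp add: span_is_subset2)
  have surj: "span (set (cols A)) = carrier_vec n \<longleftrightarrow>
      (\<forall>y \<in> carrier_vec n. \<exists>x \<in> carrier_vec nc. A *\<^sub>v x = y)"
    using col_space_eq[OF A] A unfolding col_space_def by auto
  have "rank A = n \<longleftrightarrow> span (set (cols A)) = carrier_vec n"
  proof
    assume rk: "rank A = n"
    obtain S where S: "maximal S (\<lambda>T. T \<subseteq> set (cols A) \<and> lin_indpt T)"
      using maximal_exists[of "\<lambda>T. T \<subseteq> set (cols A) \<and> lin_indpt T" "card (set (cols A))" "{}"]
      by (meson List.finite_set card_mono empty_iff empty_subsetI finite_lin_indpt2 rev_finite_subset)
    then have sS: "S \<subseteq> set (cols A)" "lin_indpt S" by (auto simp: maximal_def)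
    have "finite S" using sS finite_subset by blast
    moreover have "card S = dim" using rank_card_indpt[OF A S] rk dim_is_n by simp
    ultimately have "basis S" using sS cA by (intro dim_li_is_basis) auto
    then have "carrier_vec n = span S" by (simp add: basis_def)
    also have "\<dots> \<subseteq> span (set (cols A))" using sS by (intro span_is_monotone)
    finally show "span (set (cols A)) = carrier_vec n" using sub by blast
  next
    assume "span (set (cols A)) = carrier_vec n"
    then have "vs (span (set (cols A))) = V" by (simp add: module_vec_def)
    then show "rank A = n" unfolding rank_def using dim_is_n by simp
  qed
  with surj show ?thesis by simp
qed

end

text \<open>Conjugation is the identity on the reals, so one formula serves both fields.\<close>

definition gram_mat :: "'a::conjugatable_ring mat \<Rightarrow> 'a mat" where
  "gram_mat A = (map_mat conjugate A)\<^sup>T * A"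

lemma gram_mat_carrier [simp]: "A \<in> carrier_mat nr nc \<Longrightarrow> gram_mat A \<in> carrier_mat nc nc"
  by (simp add: gram_mat_def)

text \<open>\<open>A\<close> and its Gram matrix have the same kernel: if the Gram matrix sends
  \<open>v\<close> to 0, then the squared norm of \<open>A *\<^sub>v v\<close> is 0.\<close>

lemma det_gram_mat_eq_0_iff:
  fixes A :: "'a::conjugatable_ordered_field mat"
  assumes A: "A \<in> carrier_mat nr nc"
  shows "det (gram_mat A) = 0 \<longleftrightarrow> (\<exists>v \<in> carrier_vec nc. v \<noteq> 0\<^sub>v nc \<and> A *\<^sub>v v = 0\<^sub>v nr)"
proof -
  have "gram_mat A *\<^sub>v v = 0\<^sub>v nc \<longleftrightarrow> A *\<^sub>v v = 0\<^sub>v nr" if v: "v \<in> carrier_vec nc" for v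
  proof
    let ?w = "A *\<^sub>v v" and ?H = "(map_mat conjugate A)\<^sup>T"
    have w: "?w \<in> carrier_vec nr" using A v by simp
    have assoc: "gram_mat A *\<^sub>v v = ?H *\<^sub>v ?w"
      unfolding gram_mat_def using A v by (intro assoc_mult_mat_vec) auto
    assume "gram_mat A *\<^sub>v v = 0\<^sub>v nc"
    then have "conjugate v \<bullet> (?H *\<^sub>v ?w) = 0" using v assoc by simp
    moreover have "conjugate v \<bullet> (?H *\<^sub>v ?w) = (map_mat conjugate A *\<^sub>v conjugate v) \<bullet> ?w"
      using transpose_vec_mult_scalar[of "?H" nc nr ?w "conjugate v"] A v w by simp
    moreover have "map_mat conjugate A *\<^sub>v conjugate v = conjugate ?w"
      using A v by (intro eq_vecI) (auto simp: scalar_prod_def sum_conjugate conjugate_dist_mul)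
    ultimately have "?w \<bullet>c ?w = 0" using w by (simp add: comm_scalar_prod[of _ nr])
    then show "?w = 0\<^sub>v nr" using w by simp
  next
    assume "A *\<^sub>v v = 0\<^sub>v nr"
    then show "gram_mat A *\<^sub>v v = 0\<^sub>v nc"
      unfolding gram_mat_def using A v by (subst assoc_mult_mat_vec[of _ nc nr _ nc]) auto
  qed
  then show ?thesis using det_0_iff_vec_prod_zero_field[OF gram_mat_carrier[OF A]] by blast
qed

text \<open>Surjectivity comes from the explicit right inverse \<open>A\<^sup>H (A A\<^sup>H)\<^sup>-\<^sup>1\<close>;
  \<open>gram_mat A\<^sup>T\<close> is the transpose of \<open>A A\<^sup>H\<close>.\<close>

lemma rank_eq_nr_iff_left_kernel:
  fixes A :: "'a::conjugatable_ordered_field mat"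
  assumes A: "A \<in> carrier_mat nr nc"
  shows "vec_space.rank nr A = nr \<longleftrightarrow>
    (\<forall>w \<in> carrier_vec nr. A\<^sup>T *\<^sub>v w = 0\<^sub>v nc \<longrightarrow> w = 0\<^sub>v nr)"
proof -
  interpret vec_space "TYPE('a)" nr .
  show ?thesis unfolding rank_eq_n_iff_surj[OF A]
  proof
    assume surj: "\<forall>y \<in> carrier_vec nr. \<exists>x \<in> carrier_vec nc. A *\<^sub>v x = y"
    show "\<forall>w \<in> carrier_vec nr. A\<^sup>T *\<^sub>v w = 0\<^sub>v nc \<longrightarrow> w = 0\<^sub>v nr"
    proof (intro ballI impI)
      fix w :: "'a vec" assume w: "w \<in> carrier_vec nr" "A\<^sup>T *\<^sub>v w = 0\<^sub>v nc"
      \<comment> \<open>A preimage of the conjugate of \<open>w\<close> turns the vanishing of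
        \<open>A\<^sup>T *\<^sub>v w\<close> into that of the squared norm of
        \<open>w\<close>.\<close>
      then have cw: "conjugate w \<in> carrier_vec nr" by simp
      then obtain x where x: "x \<in> carrier_vec nc" "A *\<^sub>v x = conjugate w" using surj by blast
      have "w \<bullet>c w = (A\<^sup>T *\<^sub>v w) \<bullet> x"
        using transpose_vec_mult_scalar[OF A x(1) w(1)] x by simp
      also have "\<dots> = 0" using w x by simp
      finally show "w = 0\<^sub>v nr" using w by simp
    qed
  next
    assume ker: "\<forall>w \<in> carrier_vec nr. A\<^sup>T *\<^sub>v w = 0\<^sub>v nc \<longrightarrow> w = 0\<^sub>v nr"
    have AT: "A\<^sup>T \<in> carrier_mat nc nr" using A by simp
    have "det (gram_mat (A\<^sup>T)) \<noteq> 0" using det_gram_mat_eq_0_iff[OF AT] ker by auto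
    moreover define C where "C = (map_mat conjugate A)\<^sup>T"
    have "gram_mat (A\<^sup>T) = (A * C)\<^sup>T"
      using A by (subst transpose_mult[of _ nr nc])
        (auto simp: gram_mat_def C_def intro!: arg_cong[of _ _ "\<lambda>B. B * A\<^sup>T"] eq_matI)
    moreover have C: "C \<in> carrier_mat nc nr" using A by (simp add: C_def)
    then have AC: "A * C \<in> carrier_mat nr nr" using A by simp
    ultimately have "det (A * C) \<noteq> 0" using det_transpose[OF AC] by simp
    from det_non_zero_imp_unit[OF AC this, of "()"]
    obtain B where B: "B \<in> carrier_mat nr nr" "A * C * B = 1\<^sub>m nr"
      unfolding Units_def ring_mat_def by auto
    show "\<forall>y \<in> carrier_vec nr. \<exists>x \<in> carrier_vec nc. A *\<^sub>v x = y"
    proof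
      fix y :: "'a vec" assume y: "y \<in> carrier_vec nr"
      have "A *\<^sub>v (C *\<^sub>v (B *\<^sub>v y)) = A * C *\<^sub>v (B *\<^sub>v y)"
        using A B C y by (intro assoc_mult_mat_vec[symmetric]) auto
      also have "\<dots> = A * C * B *\<^sub>v y"
        using AC B y by (intro assoc_mult_mat_vec[symmetric]) auto
      also have "\<dots> = y" using B y by simp
      finally show "\<exists>x \<in> carrier_vec nc. A *\<^sub>v x = y"
        using C B y by (intro bexI[of _ "C *\<^sub>v (B *\<^sub>v y)"]) auto
    qed
  qed
qed

text \<open>For a non-square matrix the Gram matrix on the larger side is always singular, so the
  shape decides which side is taken.\<close>

definition gram_det :: "'a::conjugatable_ordered_field mat \<Rightarrow> 'a" where
  "gram_det A = (if dim_row A \<le> dim_col A then det (gram_mat A\<^sup>T) else det (gram_mat A))"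

lemma rank_eq_min_iff_gram_det:
  fixes A :: "'a::conjugatable_ordered_field mat"
  assumes A: "A \<in> carrier_mat nr nc"
  shows "vec_space.rank nr A = min nr nc \<longleftrightarrow> gram_det A \<noteq> 0"
proof (cases "nr \<le> nc")
  case True
  have "A\<^sup>T \<in> carrier_mat nc nr" using A by simp
  from det_gram_mat_eq_0_iff[OF this] show ?thesis
    using True A rank_eq_nr_iff_left_kernel[OF A] by (auto simp: gram_det_def min_def)
next
  case False
  then show ?thesis
    using A det_gram_mat_eq_0_iff[OF A] vec_space.rank_eq_nc_iff_kernel[OF A]
    by (auto simp: gram_det_def min_def)
qed

section \<open>Polynomial functions\<close>

text \<open>Abstracts real polynomial functions and complex functions with polynomial real and
  imaginary parts, so that determinants of Gram matrices are treated once for both fields.\<close>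

locale conjugation_algebra =
  fixes R :: "('x \<Rightarrow> 'a::conjugatable_ordered_field) \<Rightarrow> bool"
  assumes const: "R (\<lambda>x. c)"
    and add: "R f \<Longrightarrow> R g \<Longrightarrow> R (\<lambda>x. f x + g x)"
    and mult: "R f \<Longrightarrow> R g \<Longrightarrow> R (\<lambda>x. f x * g x)"
    and conj: "R f \<Longrightarrow> R (\<lambda>x. conjugate (f x))"
begin

lemma sum: "(\<And>i. i \<in> I \<Longrightarrow> R (f i)) \<Longrightarrow> R (\<lambda>x. \<Sum>i\<in>I. f i x)"
  by (induction I rule: infinite_finite_induct) (auto intro: const add)

lemma prod: "(\<And>i. i \<in> I \<Longrightarrow> R (f i)) \<Longrightarrow> R (\<lambda>x. \<Prod>i\<in>I. f i x)"
  by (induction I rule: infinite_finite_induct) (auto intro: const mult)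

lemma det:
  assumes A: "\<And>x. A x \<in> carrier_mat N N"
    and R: "\<And>i j. i < N \<Longrightarrow> j < N \<Longrightarrow> R (\<lambda>x. A x $$ (i, j))"
  shows "R (\<lambda>x. det (A x))"
proof -
  have "s i < N" if "s permutes {0..<N}" "i < N" for s i
    using permutes_in_image[OF that(1), of i] that(2) by simp
  then show ?thesis unfolding det_def'[OF A] by (intro sum mult const prod R) auto
qed

lemma det_gram_mat:
  assumes A: "\<And>x. A x \<in> carrier_mat nr nc"
    and R: "\<And>i j. i < nr \<Longrightarrow> j < nc \<Longrightarrow> R (\<lambda>x. A x $$ (i, j))"
  shows "R (\<lambda>x. det (gram_mat (A x)))"
proof (rule det)
  show "gram_mat (A x) \<in> carrier_mat nc nc" for x
    by (rule gram_mat_carrier[OF A])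
  fix i j assume ij: "i < nc" "j < nc"
  have "gram_mat (A x) $$ (i, j) = (\<Sum>l<nr. conjugate (A x $$ (l, i)) * A x $$ (l, j))" for x
    using A[of x] ij by (auto simp: gram_mat_def scalar_prod_def atLeast0LessThan intro!: sum.cong)
  then show "R (\<lambda>x. gram_mat (A x) $$ (i, j))" using ij by (auto intro!: sum mult conj R)
qed

lemma gram_det:
  assumes A: "\<And>x. A x \<in> carrier_mat nr nc"
    and R: "\<And>i j. i < nr \<Longrightarrow> j < nc \<Longrightarrow> R (\<lambda>x. A x $$ (i, j))"
  shows "R (\<lambda>x. gram_det (A x))"
proof -
  \<comment> \<open>The shape does not depend on \<open>x\<close>, so the same branch of
    \<open>gram_det\<close> applies for all \<open>x\<close>.\<close>
  have *: "dim_row (A x) = nr" "dim_col (A x) = nc" for x using A[of x] by auto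
  have "R (\<lambda>x. det (gram_mat (A x)\<^sup>T))"
    by (rule det_gram_mat[of _ nc nr]) (use A * R in auto)
  moreover have "R (\<lambda>x. det (gram_mat (A x)))" by (rule det_gram_mat[OF A R])
  ultimately show ?thesis unfolding gram_det_def * by (cases "nr \<le> nc") auto
qed

end

section \<open>Evaluation of real polynomials in several variables\<close>

definition monomial_eval :: "(nat \<Rightarrow>\<^sub>0 nat) \<Rightarrow> real vec \<Rightarrow> real" where
  "monomial_eval t x = (\<Prod>i \<in> Poly_Mapping.keys t. (x $ i) ^ Poly_Mapping.lookup t i)"

lemma monomial_eval_superset:
  assumes "finite I" "Poly_Mapping.keys t \<subseteq> I"
  shows "monomial_eval t x = (\<Prod>i \<in> I. (x $ i) ^ Poly_Mapping.lookup t i)"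
  unfolding monomial_eval_def using assms
  by (intro prod.mono_neutral_left) (auto simp: in_keys_iff)

lemma monomial_eval_add: "monomial_eval (s + t) x = monomial_eval s x * monomial_eval t x"
proof -
  let ?I = "Poly_Mapping.keys s \<union> Poly_Mapping.keys t"
  have "monomial_eval r x = (\<Prod>i \<in> ?I. (x $ i) ^ Poly_Mapping.lookup r i)"
    if "r \<in> {s, t, s + t}" for r
    using that Poly_Mapping.keys_add[of s t] by (intro monomial_eval_superset) auto
  then show ?thesis by (simp add: lookup_add power_add prod.distrib)
qed

text \<open>Absent monomials have coefficient 0. This matters for sums, where cancellation can make
  the keys smaller than the union.\<close>

lemma mpoly_eval_superset:
  assumes "finite T" "Poly_Mapping.keys P \<subseteq> T"
  shows "mpoly_eval P x = (\<Sum>t \<in> T. Poly_Mapping.lookup P t * monomial_eval t x)"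
  unfolding mpoly_eval_def monomial_eval_def[symmetric] using assms
  by (intro sum.mono_neutral_left) (auto simp: in_keys_iff)

lemma mpoly_eval_add: "mpoly_eval (P + Q) x = mpoly_eval P x + mpoly_eval Q x"
proof -
  let ?T = "Poly_Mapping.keys P \<union> Poly_Mapping.keys Q"
  have "mpoly_eval R x = (\<Sum>t \<in> ?T. Poly_Mapping.lookup R t * monomial_eval t x)"
    if "R \<in> {P, Q, P + Q}" for R
    using that Poly_Mapping.keys_add[of P Q] by (intro mpoly_eval_superset) auto
  then show ?thesis by (simp add: lookup_add algebra_simps sum.distrib)
qed

definition polynomial_fun :: "nat \<Rightarrow> (real vec \<Rightarrow> real) \<Rightarrow> bool" where
  "polynomial_fun p f \<longleftrightarrow> (\<exists>P. in_variables p P \<and> f = mpoly_eval P)"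

lemma polynomial_fun_add:
  assumes "polynomial_fun p f" "polynomial_fun p g"
  shows "polynomial_fun p (\<lambda>x. f x + g x)"
proof -
  obtain P Q where PQ: "in_variables p P" "f = mpoly_eval P" "in_variables p Q" "g = mpoly_eval Q"
    using assms by (auto simp: polynomial_fun_def)
  have "in_variables p (P + Q)"
    using PQ Poly_Mapping.keys_add[of P Q] unfolding in_variables_def by blast
  then show ?thesis unfolding polynomial_fun_def
    using PQ by (intro exI[of _ "P + Q"]) (auto simp: mpoly_eval_add)
qed

lemma polynomial_fun_monomial:
  assumes "Poly_Mapping.keys t \<subseteq> {..<p}"
  shows "polynomial_fun p (\<lambda>x. c * monomial_eval t x)"
  unfolding polynomial_fun_def
proof (intro exI[of _ "Poly_Mapping.single t c"] conjI ext)
  show "in_variables p (Poly_Mapping.single t c)" using assms by (simp add: in_variables_def)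
  show "c * monomial_eval t x = mpoly_eval (Poly_Mapping.single t c) x" for x
    by (subst mpoly_eval_superset[of "{t}"]) auto
qed

lemma polynomial_fun_const: "polynomial_fun p (\<lambda>x. c)"
  using polynomial_fun_monomial[of 0 p c] by (simp add: monomial_eval_def)

lemma polynomial_fun_coord: "i < p \<Longrightarrow> polynomial_fun p (\<lambda>x. x $ i)"
  using polynomial_fun_monomial[of "Poly_Mapping.single i 1" p 1] by (simp add: monomial_eval_def)

lemma polynomial_fun_sum:
  "(\<And>i. i \<in> I \<Longrightarrow> polynomial_fun p (f i)) \<Longrightarrow> polynomial_fun p (\<lambda>x. \<Sum>i\<in>I. f i x)"
  by (induction I rule: infinite_finite_induct) (auto intro: polynomial_fun_const polynomial_fun_add)

text \<open>The product is expanded into a finite sum of monomials, which reduces the claim to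
  closure under sums.\<close>

lemma polynomial_fun_mult:
  assumes "polynomial_fun p f" "polynomial_fun p g"
  shows "polynomial_fun p (\<lambda>x. f x * g x)"
proof -
  obtain P Q where PQ: "in_variables p P" "f = mpoly_eval P" "in_variables p Q" "g = mpoly_eval Q"
    using assms by (auto simp: polynomial_fun_def)
  have "f x * g x = (\<Sum>s \<in> Poly_Mapping.keys P. \<Sum>t \<in> Poly_Mapping.keys Q.
      (Poly_Mapping.lookup P s * Poly_Mapping.lookup Q t) * monomial_eval (s + t) x)" for x
    unfolding PQ mpoly_eval_def monomial_eval_def[symmetric] sum_product monomial_eval_add
    by (simp add: mult_ac)
  moreover have "Poly_Mapping.keys (s + t) \<subseteq> {..<p}"
    if "s \<in> Poly_Mapping.keys P" "t \<in> Poly_Mapping.keys Q" for s t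
    using that PQ Poly_Mapping.keys_add[of s t] unfolding in_variables_def by blast
  ultimately show ?thesis by (auto intro!: polynomial_fun_sum polynomial_fun_monomial)
qed

text \<open>Polynomial in the real coordinates rather than in the complex entries, since Gram
  matrices involve conjugation.\<close>

definition complex_polynomial_fun :: "nat \<Rightarrow> (real vec \<Rightarrow> complex) \<Rightarrow> bool" where
  "complex_polynomial_fun p f \<longleftrightarrow>
     polynomial_fun p (\<lambda>x. Re (f x)) \<and> polynomial_fun p (\<lambda>x. Im (f x))"

lemma conjugation_algebra_polynomial_fun: "conjugation_algebra (polynomial_fun p)"
  by unfold_locales
    (auto intro: polynomial_fun_const polynomial_fun_add polynomial_fun_mult)

lemma polynomial_fun_uminus: "polynomial_fun p f \<Longrightarrow> polynomial_fun p (\<lambda>x. - f x)"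
  using polynomial_fun_mult[OF polynomial_fun_const[of p "-1"], of f] by simp

lemma conjugation_algebra_complex_polynomial_fun:
  "conjugation_algebra (complex_polynomial_fun p)"
  by unfold_locales
    (auto simp: complex_polynomial_fun_def diff_conv_add_uminus
      simp del: add_uminus_conv_diff
      intro!: polynomial_fun_const polynomial_fun_add polynomial_fun_mult polynomial_fun_uminus)

lemma algebraic_set_zeros:
  assumes "polynomial_fun p f"
  shows "algebraic_set p {x \<in> carrier_vec p. f x = 0}"
proof -
  obtain P where "in_variables p P" "f = mpoly_eval P"
    using assms by (auto simp: polynomial_fun_def)
  then show ?thesis unfolding algebraic_set_def by (intro exI[of _ "{P}"]) auto
qed

text \<open>One complex equation is a pair of real ones.\<close>

lemma algebraic_set_zeros_complex:
  assumes "complex_polynomial_fun p f"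
  shows "algebraic_set p {x \<in> carrier_vec p. f x = 0}"
proof -
  obtain P Q where "in_variables p P" "(\<lambda>x. Re (f x)) = mpoly_eval P"
    "in_variables p Q" "(\<lambda>x. Im (f x)) = mpoly_eval Q"
    using assms by (auto simp: complex_polynomial_fun_def polynomial_fun_def)
  then show ?thesis unfolding algebraic_set_def
    by (intro exI[of _ "{P, Q}"]) (auto simp: complex_eq_iff fun_eq_iff)
qed

section \<open>Sylvester matrices\<close>

lemma sum_lessThan_mult:
  fixes f :: "nat \<Rightarrow> 'a::comm_monoid_add"
  shows "(\<Sum>r<k * q. f r) = (\<Sum>b<k. \<Sum>i<q. f (b * q + i))"
proof -
  have "(\<Sum>r<k * q. f r) = (\<Sum>b<k. sum f {b * q..<b * q + q})"
    by (rule sum.nat_group[symmetric])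
  moreover have "sum f {b * q..<b * q + q} = (\<Sum>i<q. f (b * q + i))" for b
    using sum.shift_bounds_nat_ivl[of f 0 "b * q" q] by (simp add: atLeast0LessThan add.commute)
  ultimately show ?thesis by simp
qed

lemma block_index_less: "b < k \<Longrightarrow> i < q \<Longrightarrow> b * q + i < k * (q::nat)"
  by (metis add.right_neutral div_less div_less_iff_less_mult div_mult_self3 not_less_zero
      gr_zeroI)

text \<open>Reads the coefficients from a list \<open>g\<close>, so that every entry is visibly 0 or
  a single coordinate; this makes the Gram determinants polynomial in the coordinates.\<close>

definition sylvester_of :: "nat \<Rightarrow> nat \<Rightarrow> nat \<Rightarrow> nat \<Rightarrow> (nat \<Rightarrow> 'a::zero) \<Rightarrow> 'a mat" where
  "sylvester_of m n d k g =
     mat ((k + d) * m) (k * (m + n))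
       (\<lambda>(r, c). let i = r div m; j = c div (m + n) in
          if j \<le> i \<and> i - j \<le> d
          then g (((i - j) * m + r mod m) * (m + n) + c mod (m + n)) else 0)"

lemma sylvester_of_carrier [simp]:
  "sylvester_of m n d k g \<in> carrier_mat ((k + d) * m) (k * (m + n))"
  by (simp add: sylvester_of_def)

lemma sylvester_mat_carrier [simp]:
  "sylvester_mat m n d M k \<in> carrier_mat ((k + d) * m) (k * (m + n))"
  by (simp add: sylvester_mat_def)

lemma list_coeff_index_less:
  fixes m n d :: nat
  assumes "l \<le> d" "i < m" "j < m + n"
  shows "(l * m + i) * (m + n) + j < (d + 1) * m * (m + n)"
  by (intro block_index_less) (use assms in auto)

lemma sylvester_mat_eq_sylvester_of:
  assumes m: "m > 0" and g: "\<And>s. s < (d + 1) * m * (m + n) \<Longrightarrow> g s = list_coeff m n M s"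
  shows "sylvester_mat m n d M k = sylvester_of m n d k g"
proof -
  have "g ((l * m + r mod m) * (m + n) + c mod (m + n)) =
      coeff_mat M l $$ (r mod m, c mod (m + n))" if "l \<le> d" for l r c
  proof -
    have *: "r mod m < m" "c mod (m + n) < m + n" using m by auto
    then have "((l * m + r mod m) * (m + n) + c mod (m + n)) div (m + n) = l * m + r mod m"
      "((l * m + r mod m) * (m + n) + c mod (m + n)) mod (m + n) = c mod (m + n)" by auto
    with * show ?thesis
      using g[OF list_coeff_index_less[OF that *]] by (simp add: list_coeff_def)
  qed
  then show ?thesis unfolding sylvester_mat_def sylvester_of_def Let_def
    by (intro eq_matI) auto
qed

section \<open>Kernels of Sylvester matrices, block by block\<close>

lemma sylvester_mat_index:
  assumes "M \<in> carrier_mat m (m + n)" "b < k + d" "i < m" "a < k" "j < m + n"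
  shows "sylvester_mat m n d M k $$ (b * m + i, a * (m + n) + j) =
    (if a \<le> b \<and> b - a \<le> d then coeff (M $$ (i, j)) (b - a) else 0)"
proof -
  have "b * m + i < (k + d) * m" "a * (m + n) + j < k * (m + n)"
    using assms by (auto intro: block_index_less)
  moreover have "(b * m + i) div m = b" "(b * m + i) mod m = i"
    "(a * (m + n) + j) div (m + n) = a" "(a * (m + n) + j) mod (m + n) = j"
    using assms by auto
  ultimately show ?thesis using assms by (simp add: sylvester_mat_def Let_def coeff_mat_def)
qed

lemma all_block_index:
  "(\<forall>r < k * q. P r) \<longleftrightarrow> (\<forall>b < k. \<forall>i < q. P (b * q + i))" for q :: nat
proof
  assume *: "\<forall>b < k. \<forall>i < q. P (b * q + i)"
  show "\<forall>r < k * q. P r"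
  proof (intro allI impI)
    fix r assume r: "r < k * q"
    then have "r div q < k" "r mod q < q"
      by (auto simp: less_mult_imp_div_less intro!: mod_less_divisor gr0I)
    with * have "P (r div q * q + r mod q)" by blast
    then show "P r" by simp
  qed
qed (auto intro: block_index_less)

text \<open>Block column \<open>a\<close> carries the coefficients of degree
  \<open>0, ..., d\<close> in the block rows \<open>a, ..., a + d\<close>. Its equations see only
  that window of \<open>w\<close> and have the same shape for all \<open>a\<close>.\<close>

lemma sylvester_left_kernel_iff:
  fixes w :: "'a::field vec"
  assumes M: "M \<in> carrier_mat m (m + n)" and w: "w \<in> carrier_vec ((k + d) * m)"
  shows "(sylvester_mat m n d M k)\<^sup>T *\<^sub>v w = 0\<^sub>v (k * (m + n)) \<longleftrightarrow>
    (\<forall>a < k. \<forall>j < m + n. (\<Sum>l\<le>d. \<Sum>i<m. coeff (M $$ (i, j)) l * w $ ((a + l) * m + i)) = 0)"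
proof -
  let ?S = "sylvester_mat m n d M k"
  have dims: "dim_row ?S = (k + d) * m" "dim_col ?S = k * (m + n)"
    by (simp_all add: sylvester_mat_def)
  have entry: "((?S)\<^sup>T *\<^sub>v w) $ (a * (m + n) + j) =
      (\<Sum>l\<le>d. \<Sum>i<m. coeff (M $$ (i, j)) l * w $ ((a + l) * m + i))"
    if aj: "a < k" "j < m + n" for a j
  proof -
    have "((?S)\<^sup>T *\<^sub>v w) $ (a * (m + n) + j) =
        (\<Sum>r<(k + d) * m. ?S $$ (r, a * (m + n) + j) * w $ r)"
      using block_index_less[OF aj] w dims by (simp add: scalar_prod_def atLeast0LessThan)
    also have "\<dots> = (\<Sum>b<k + d. \<Sum>i<m.
        (if a \<le> b \<and> b - a \<le> d then coeff (M $$ (i, j)) (b - a) else 0) * w $ (b * m + i))"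
      unfolding sum_lessThan_mult using sylvester_mat_index[OF M _ _ aj] by simp
    also have "\<dots> = (\<Sum>b\<in>{a..a + d}. \<Sum>i<m. coeff (M $$ (i, j)) (b - a) * w $ (b * m + i))"
      using aj by (intro sum.mono_neutral_cong_right) (auto intro!: sum.neutral)
    also have "\<dots> = (\<Sum>l\<le>d. \<Sum>i<m. coeff (M $$ (i, j)) l * w $ ((a + l) * m + i))"
      by (rule sum.reindex_bij_witness[of _ "\<lambda>l. a + l" "\<lambda>b. b - a"]) auto
    finally show ?thesis .
  qed
  have "(?S)\<^sup>T *\<^sub>v w = 0\<^sub>v (k * (m + n)) \<longleftrightarrow> (\<forall>c < k * (m + n). ((?S)\<^sup>T *\<^sub>v w) $ c = 0)"
    using dims by (auto simp: vec_eq_iff simp del: index_mult_mat_vec)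
  also have "\<dots> \<longleftrightarrow> (\<forall>a < k. \<forall>j < m + n. ((?S)\<^sup>T *\<^sub>v w) $ (a * (m + n) + j) = 0)"
    by (rule all_block_index)
  finally show ?thesis using entry by simp
qed

lemma sylvester_right_kernel_index:
  fixes v :: "'a::field vec"
  assumes M: "M \<in> carrier_mat m (m + n)" and v: "v \<in> carrier_vec (k * (m + n))"
    and bi: "b < k + d" "i < m"
  shows "(sylvester_mat m n d M k *\<^sub>v v) $ (b * m + i) =
    (\<Sum>a<k. \<Sum>j<m + n. (if a \<le> b \<and> b - a \<le> d then coeff (M $$ (i, j)) (b - a) else 0) *
       v $ (a * (m + n) + j))"
proof -
  let ?S = "sylvester_mat m n d M k"
  have dims: "dim_row ?S = (k + d) * m" "dim_col ?S = k * (m + n)"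
    by (simp_all add: sylvester_mat_def)
  have "(?S *\<^sub>v v) $ (b * m + i) = (\<Sum>c<k * (m + n). ?S $$ (b * m + i, c) * v $ c)"
    using block_index_less[OF bi] v dims by (simp add: scalar_prod_def atLeast0LessThan)
  then show ?thesis unfolding sum_lessThan_mult using sylvester_mat_index[OF M bi] by simp
qed

text \<open>A left null vector of \<open>S\<^bsub>k+1\<^esub>\<close> restricts to left null vectors of \<open>S\<^bsub>k\<^esub>\<close> by dropping
  its last or its first block.\<close>

lemma sylvester_full_row_rank_Suc:
  fixes M :: "'a::conjugatable_ordered_field poly mat"
  assumes M: "M \<in> carrier_mat m (m + n)" and "k + d > 0"
    and rk: "vec_space.rank ((k + d) * m) (sylvester_mat m n d M k) = (k + d) * m"
  shows "vec_space.rank ((Suc k + d) * m) (sylvester_mat m n d M (Suc k)) = (Suc k + d) * m"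
  unfolding rank_eq_nr_iff_left_kernel[OF sylvester_mat_carrier]
proof (intro ballI impI)
  fix w :: "'a vec" assume w: "w \<in> carrier_vec ((Suc k + d) * m)"
    and "(sylvester_mat m n d M (Suc k))\<^sup>T *\<^sub>v w = 0\<^sub>v (Suc k * (m + n))"
  then have eq: "(\<Sum>l\<le>d. \<Sum>i<m. coeff (M $$ (i, j)) l * w $ ((a + l) * m + i)) = 0"
    if "a < Suc k" "j < m + n" for a j
    using sylvester_left_kernel_iff[OF M w] that by simp
  have ker: "u = 0\<^sub>v ((k + d) * m)" if "u \<in> carrier_vec ((k + d) * m)"
    "(sylvester_mat m n d M k)\<^sup>T *\<^sub>v u = 0\<^sub>v (k * (m + n))" for u
    using rk that rank_eq_nr_iff_left_kernel[OF sylvester_mat_carrier[of m n d M k]] by blast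
  \<comment> \<open>\<open>e = 0\<close> drops the last block of \<open>w\<close> and
    \<open>e = 1\<close> the first; equation \<open>a\<close> for the shorter vector is equation
    \<open>e + a\<close> for \<open>w\<close>.\<close>
  have shift: "vec ((k + d) * m) (\<lambda>r. w $ (e * m + r)) = 0\<^sub>v ((k + d) * m)" if "e \<le> 1" for e
  proof (rule ker)
    let ?u = "vec ((k + d) * m) (\<lambda>r. w $ (e * m + r))"
    show "?u \<in> carrier_vec ((k + d) * m)" by simp
    have "(\<Sum>l\<le>d. \<Sum>i<m. coeff (M $$ (i, j)) l * ?u $ ((a + l) * m + i)) = 0"
      if "a < k" "j < m + n" for a j
    proof -
      have "(\<Sum>l\<le>d. \<Sum>i<m. coeff (M $$ (i, j)) l * ?u $ ((a + l) * m + i)) =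
          (\<Sum>l\<le>d. \<Sum>i<m. coeff (M $$ (i, j)) l * w $ ((e + a + l) * m + i))"
      proof (intro sum.cong refl)
        fix l i assume "l \<in> {..d}" "i \<in> {..<m}"
        then have "(a + l) * m + i < (k + d) * m" using \<open>a < k\<close> by (intro block_index_less) auto
        then show "coeff (M $$ (i, j)) l * ?u $ ((a + l) * m + i) =
            coeff (M $$ (i, j)) l * w $ ((e + a + l) * m + i)"
          by (simp add: add_mult_distrib add.assoc)
      qed
      then show ?thesis using eq[of "e + a" j] that \<open>e \<le> 1\<close> by simp
    qed
    then show "(sylvester_mat m n d M k)\<^sup>T *\<^sub>v ?u = 0\<^sub>v (k * (m + n))"
      using sylvester_left_kernel_iff[OF M, of ?u k d] by simp
  qed
  show "w = 0\<^sub>v ((Suc k + d) * m)"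
  proof (rule eq_vecI)
    fix r assume "r < dim_vec (0\<^sub>v ((Suc k + d) * m) :: 'a vec)"
    then have r: "r < m + (k + d) * m" by simp
    show "w $ r = 0\<^sub>v ((Suc k + d) * m) $ r"
    proof (cases "r < (k + d) * m")
      case True
      then show ?thesis using arg_cong[OF shift[of 0], of "\<lambda>u. u $ r"] r by simp
    next
      case False
      \<comment> \<open>The entry lies in the last block and survives, as entry
        \<open>r - m\<close>, when the first block is dropped; \<open>k + d > 0\<close> ensures
        \<open>m \<le> r\<close>.\<close>
      have "m \<le> (k + d) * m" using \<open>k + d > 0\<close> by (cases "k + d") auto
      then have "m \<le> r" "r - m < (k + d) * m" using False r by linarith+
      then show ?thesis using arg_cong[OF shift[of 1], of "\<lambda>u. u $ (r - m)"] r by simp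
    qed
  qed (use w in auto)
qed

text \<open>An algebraic set has finitely many equations, so the rank conditions must be bounded.
  From \<open>k = d * m\<close> on, \<open>n > 0\<close> makes the matrix wide, and full row rank is
  inherited upwards.\<close>

lemma full_Sylvester_rank_iff_bounded:
  fixes M :: "'a::conjugatable_ordered_field poly mat"
  assumes M: "M \<in> carrier_mat m (m + n)" and pos: "m > 0" "n > 0" "d > 0"
  shows "full_Sylvester_rank m n d M \<longleftrightarrow>
    (\<forall>k \<in> {1..d * m}. vec_space.rank ((k + d) * m) (sylvester_mat m n d M k) =
       min ((k + d) * m) (k * (m + n)))"
proof
  assume *: "\<forall>k \<in> {1..d * m}. vec_space.rank ((k + d) * m) (sylvester_mat m n d M k) =
       min ((k + d) * m) (k * (m + n))"
  have wide: "min ((k + d) * m) (k * (m + n)) = (k + d) * m" if "k \<ge> d * m" for k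
  proof -
    have "k * 1 \<le> k * n" using pos by (intro mult_le_mono2) simp
    then have "d * m \<le> k * n" using that by linarith
    then show ?thesis unfolding add_mult_distrib add_mult_distrib2 by simp
  qed
  have full: "vec_space.rank ((k + d) * m) (sylvester_mat m n d M k) = (k + d) * m"
    if "k \<ge> d * m" for k
    using that
  proof (induction k rule: dec_induct)
    case base
    have "d * m \<in> {1..d * m}" using pos by simp
    from trans[OF bspec[OF * this] wide] show ?case by simp
  next
    case (step k)
    then show ?case using pos by (intro sylvester_full_row_rank_Suc[OF M]) auto
  qed
  show "full_Sylvester_rank m n d M" unfolding full_Sylvester_rank_def
  proof (intro allI impI)
    fix k :: nat assume "k \<ge> 1"
    show "vec_space.rank ((k + d) * m) (sylvester_mat m n d M k) =
       min ((k + d) * m) (k * (m + n))"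
    proof (cases "k \<le> d * m")
      case True
      then show ?thesis using * \<open>k \<ge> 1\<close> by simp
    next
      case False
      then show ?thesis using full[of k] wide[of k] by simp
    qed
  qed
qed (simp add: full_Sylvester_rank_def)

section \<open>A zigzag matrix of full Sylvester rank\<close>

locale zigzag =
  fixes m n d :: nat
  assumes m: "m > 0" and n: "n > 0" and d: "d > 0"
begin

text \<open>Rounding down makes each gap between consecutive cuts the floor or the ceiling of the
  quotient of \<open>d * m\<close> by \<open>n\<close>; the two rank arguments use one bound
  each.\<close>

definition cut :: "nat \<Rightarrow> nat" where
  "cut j = j * (d * m) div n"

text \<open>A cut on a common endpoint goes to the row that begins there. The last cut, at
  \<open>d * m\<close>, has no such row; the minimum assigns it to row \<open>m - 1\<close>, where
  it gets degree \<open>d\<close>.\<close>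

definition cut_row :: "nat \<Rightarrow> nat" where
  "cut_row j = min (cut j div d) (m - 1)"

definition cut_deg :: "nat \<Rightarrow> nat" where
  "cut_deg j = cut j - cut_row j * d"

text \<open>Columns \<open>0, \<dots>, n\<close> belong to the cuts; column \<open>n + i\<close> with \<open>0 < i < m\<close> links the rows
  \<open>i - 1\<close> and \<open>i\<close>.\<close>

definition zigzag_mat :: "'a::field poly mat" where
  "zigzag_mat = mat m (m + n) (\<lambda>(i, j).
     if j \<le> n then (if i = cut_row j then monom 1 (cut_deg j) else 0)
     else (if i + n + 1 = j then monom 1 d else 0) - (if i + n = j then 1 else 0))"

lemma cut_le: "j \<le> n \<Longrightarrow> cut j \<le> d * m"
  unfolding cut_def using n
  by (metis div_le_mono mult_le_mono1 nonzero_mult_div_cancel_left not_less_zero)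

lemma cut_row_less: "cut_row j < m"
  using m by (simp add: cut_row_def)

lemma cut_row_le: "cut_row j * d \<le> cut j"
proof -
  have "cut_row j * d \<le> cut j div d * d" by (simp add: cut_row_def)
  also have "\<dots> \<le> cut j" by simp
  finally show ?thesis .
qed

lemma cut_eq: "cut j = cut_row j * d + cut_deg j"
  using cut_row_le[of j] by (simp add: cut_deg_def)

lemma cut_deg_le:
  assumes "j \<le> n"
  shows "cut_deg j \<le> d"
proof (cases "cut j div d \<le> m - 1")
  case True
  then have "cut_deg j = cut j mod d"
    by (simp add: cut_deg_def cut_row_def minus_div_mult_eq_mod)
  then show ?thesis using d by (simp add: less_imp_le)
next
  case False
  then have "cut_row j = m - 1" by (simp add: cut_row_def)
  moreover have "cut j \<le> (m - 1) * d + d" using cut_le[OF assms] m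
    by (cases m) (auto simp: algebra_simps)
  ultimately show ?thesis by (simp add: cut_deg_def)
qed

text \<open>The integer \<open>k\<close> can be moved under the floor, where it costs at most one
  step of the cuts. The windows of length \<open>k\<close> that start at the cuts are thus
  disjoint.\<close>

lemma cut_gap_le:
  assumes "k * n \<le> d * m" "j < j'"
  shows "cut j + k \<le> cut j'"
proof -
  have "cut j + k = (j * (d * m) + k * n) div n" using n by (simp add: cut_def)
  also have "\<dots> \<le> (Suc j * (d * m)) div n" using assms(1) by (intro div_le_mono) simp
  also have "\<dots> \<le> cut j'"
    unfolding cut_def using assms(2) by (intro div_le_mono mult_le_mono1) simp
  finally show ?thesis .
qed

text \<open>Here consecutive cuts are at most \<open>k\<close> apart, so these windows leave no
  hole, and the one at the last cut reaches up to \<open>d * m + k\<close>.\<close>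

lemma cut_window_ex:
  assumes "d * m \<le> k * n" "u < d * m + k"
  shows "\<exists>j \<le> n. cut j \<le> u \<and> u < cut j + k"
proof (cases "d * m \<le> u")
  case True
  then show ?thesis using assms(2) n by (intro exI[of _ n]) (simp add: cut_def)
next
  case False
  \<comment> \<open>The first cut beyond \<open>u\<close> is not \<open>cut 0 = 0\<close>; its
    predecessor is at most \<open>u\<close>, and the gap bound does the rest.\<close>
  define j where "j = (LEAST j. u < cut j)"
  have "u < cut n" using False n by (simp add: cut_def)
  then have j: "u < cut j" "j \<le> n" unfolding j_def by (rule LeastI, rule Least_le)
  then obtain i where i: "j = Suc i" by (cases j) (auto simp: cut_def)
  have "\<not> u < cut i" using i not_less_Least[of i "\<lambda>j. u < cut j"] by (simp add: j_def)
  moreover have "cut j \<le> (i * (d * m) + k * n) div n"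
    unfolding cut_def i using assms(1) by (intro div_le_mono) simp
  then have "cut j \<le> cut i + k" using n by (simp add: cut_def)
  ultimately show ?thesis using i j by (intro exI[of _ i]) auto
qed

lemma coeff_zigzag_mat:
  assumes "i < m" "j < m + n"
  shows "coeff (zigzag_mat $$ (i, j)) l =
    (if j \<le> n then (if i = cut_row j \<and> l = cut_deg j then 1 else 0)
     else (if i + n + 1 = j \<and> l = d then 1 else 0) - (if i + n = j \<and> l = 0 then 1 else 0))"
  using assms by (auto simp: zigzag_mat_def)

lemma zigzag_mat_carrier: "zigzag_mat \<in> carrier_mat m (m + n)"
  by (simp add: zigzag_mat_def)

lemma zigzag_mat_in_poly_mats: "zigzag_mat \<in> poly_mats m n d"
  unfolding poly_mats_def using zigzag_mat_carrier
  by (auto intro!: degree_le simp: coeff_zigzag_mat) (metis cut_deg_le not_less)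

text \<open>Index the entry \<open>(b, i)\<close> of a left null vector by its position \<open>i d + b\<close>: the link columns
  make the entry at a given position independent of the row \<open>i\<close>, and every position lies less
  than \<open>k\<close> beyond some cut, where the entry vanishes.\<close>

lemma rank_zigzag_wide:
  fixes k :: nat
  assumes wide: "d * m \<le> k * n"
  shows "vec_space.rank ((k + d) * m)
    (sylvester_mat m n d (zigzag_mat :: 'a::conjugatable_ordered_field poly mat) k) = (k + d) * m"
  unfolding rank_eq_nr_iff_left_kernel[OF sylvester_mat_carrier]
proof (intro ballI impI)
  fix w :: "'a vec" assume w: "w \<in> carrier_vec ((k + d) * m)"
    and "(sylvester_mat m n d zigzag_mat k)\<^sup>T *\<^sub>v w = 0\<^sub>v (k * (m + n))"
  then have eq: "(\<Sum>l\<le>d. \<Sum>i<m. coeff (zigzag_mat $$ (i, j)) l * w $ ((a + l) * m + i)) = 0"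
    if "a < k" "j < m + n" for a j
    using sylvester_left_kernel_iff[OF zigzag_mat_carrier w] that by simp
  have pick: "(\<Sum>l\<le>d. \<Sum>i<m. (if i = i0 \<and> l = l0 then 1 else 0) * f l i) = (f l0 i0 :: 'a)"
    if "l0 \<le> d" "i0 < m" for l0 i0 f
  proof -
    have "(\<Sum>i<m. (if i = i0 \<and> l = l0 then 1 else 0) * f l i) = (if l = l0 then f l i0 else 0)" for l
      using that by (auto simp: if_distrib[of "\<lambda>x. x * _"] cong: if_cong)
    then show ?thesis using that by simp
  qed
  \<comment> \<open>A cut column has a single nonzero entry, a monomial, so its equations isolate
    the entries of \<open>w\<close> at the positions \<open>cut j + a\<close>.\<close>
  have cut0: "w $ ((a + cut_deg j) * m + cut_row j) = 0" if "a < k" "j \<le> n" for a j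
  proof -
    have "(\<Sum>l\<le>d. \<Sum>i<m. coeff (zigzag_mat $$ (i, j)) l * w $ ((a + l) * m + i)) =
        (\<Sum>l\<le>d. \<Sum>i<m. (if i = cut_row j \<and> l = cut_deg j then 1 else 0) * w $ ((a + l) * m + i))"
      using that m by (intro sum.cong refl) (simp add: coeff_zigzag_mat)
    then show ?thesis
      using eq[of a j] that m pick[of "cut_deg j" "cut_row j" "\<lambda>l i. w $ ((a + l) * m + i)"]
        cut_deg_le cut_row_less by simp
  qed
  \<comment> \<open>The column linking rows \<open>i\<close> and \<open>Suc i\<close> compares two
    entries, both at position \<open>Suc i * d + a\<close>.\<close>
  have link: "w $ ((a + d) * m + i) = w $ (a * m + Suc i)" if "a < k" "Suc i < m" for a i
  proof -
    have "(\<Sum>l\<le>d. \<Sum>i'<m. coeff (zigzag_mat $$ (i', n + Suc i)) l * w $ ((a + l) * m + i')) =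
        (\<Sum>l\<le>d. \<Sum>i'<m. (if i' = i \<and> l = d then 1 else 0) * w $ ((a + l) * m + i')
          - (if i' = Suc i \<and> l = 0 then 1 else 0) * w $ ((a + l) * m + i'))"
      using that by (intro sum.cong refl) (auto simp: coeff_zigzag_mat)
    also have "\<dots> = w $ ((a + d) * m + i) - w $ (a * m + Suc i)"
      unfolding sum_subtractf using that pick[of d i "\<lambda>l i. w $ ((a + l) * m + i)"]
        pick[of 0 "Suc i" "\<lambda>l i. w $ ((a + l) * m + i)"] by simp
    finally show ?thesis using eq[of a "n + Suc i"] that by simp
  qed
  \<comment> \<open>Row \<open>i\<close> contains the positions from \<open>i * d\<close> to below
    \<open>i * d + d + k\<close>. The rows containing \<open>u\<close> are consecutive, so the links
    can be chained.\<close>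
  have mono: "w $ ((u - i * d) * m + i) = w $ ((u - i' * d) * m + i')"
    if "i \<le> i'" "i' < m" "i' * d \<le> u" "u < i * d + d + k" for i i' u
    using that
  proof (induction i' rule: dec_induct)
    case (step i')
    define a where "a = u - Suc i' * d"
    have "i * d \<le> i' * d" using step.hyps by simp
    moreover have Suc: "Suc i' * d = i' * d + d" by simp
    ultimately have a: "a < k" "u - i' * d = a + d"
      using step.prems unfolding a_def by linarith+
    have "w $ ((u - i * d) * m + i) = w $ ((u - i' * d) * m + i')"
      by (rule step.IH) (use step.prems Suc in linarith)+
    also have "\<dots> = w $ (a * m + Suc i')"
      unfolding a(2) using a(1) step.prems(1) by (rule link)
    finally show ?case by (simp only: a_def)
  qed simp
  have const: "w $ ((u - i * d) * m + i) = w $ ((u - i' * d) * m + i')"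
    if "i < m" "i' < m" "i * d \<le> u" "u < i * d + d + k"
      "i' * d \<le> u" "u < i' * d + d + k" for i i' u
  proof (cases "i \<le> i'")
    case True
    then show ?thesis using mono that by blast
  next
    case False
    then show ?thesis using mono[of i' i u] that by simp
  qed
  have "\<forall>r < (k + d) * m. w $ r = 0" unfolding all_block_index
  proof (intro allI impI)
    fix b i assume bi: "b < k + d" "i < m"
    have "Suc i * d \<le> m * d" using bi by (intro mult_le_mono1) simp
    then have "i * d + b < d * m + k" using bi by (simp add: mult.commute)
    from cut_window_ex[OF wide this] obtain j
      where j: "j \<le> n" "cut j \<le> i * d + b" "i * d + b < cut j + k" by blast
    define u where "u = i * d + b"
    \<comment> \<open>The row of the cut also contains \<open>u\<close>, because
      \<open>cut_deg j \<le> d\<close>; the entry is moved there, where the cut column forces it to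
      be 0.\<close>
    have "w $ ((u - i * d) * m + i) = w $ ((u - cut_row j * d) * m + cut_row j)"
      using j bi cut_row_less cut_row_le[of j] cut_eq[of j] cut_deg_le[of j]
      by (intro const) (auto simp: u_def)
    moreover have "u - cut_row j * d = (u - cut j) + cut_deg j"
      using j cut_eq[of j] by (simp add: u_def)
    ultimately have "w $ (b * m + i) = w $ ((u - cut j + cut_deg j) * m + cut_row j)"
      by (simp add: u_def)
    then show "w $ (b * m + i) = 0" using cut0[of "u - cut j" j] j by (simp add: u_def)
  qed
  then show "w = 0\<^sub>v ((k + d) * m)" using w by (intro eq_vecI) auto
qed


text \<open>Adding the entries of a product \<open>S v\<close> over all rows at a common position cancels the link
  columns and leaves at most one cut column, as the cuts are at least \<open>k\<close> apart.\<close>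

lemma rank_zigzag_tall:
  fixes k :: nat
  assumes tall: "k * n \<le> d * m"
  shows "vec_space.rank ((k + d) * m) (sylvester_mat m n d (zigzag_mat :: 'a::field poly mat) k)
    = k * (m + n)"
  unfolding vec_space.rank_eq_nc_iff_kernel[OF sylvester_mat_carrier]
proof (intro ballI impI)
  fix v :: "'a vec" assume v: "v \<in> carrier_vec (k * (m + n))"
    and Sv: "sylvester_mat m n d zigzag_mat k *\<^sub>v v = 0\<^sub>v ((k + d) * m)"
  define V where "V a j = v $ (a * (m + n) + j)" for a j
  \<comment> \<open>The link column of rows \<open>i - 1\<close> and \<open>i\<close> acts in both
    rows at the same position, so \<open>E i u\<close> is its coefficient there. The value 0 for
    \<open>i = 0\<close> and \<open>i = m\<close> stands for the missing links at the two
    ends.\<close>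
  define E where "E i u = (if 1 \<le> i \<and> i < m \<and> i * d \<le> u \<and> u < i * d + k
    then V (u - i * d) (n + i) else 0)" for i u
  define s where "s i u = (\<Sum>j\<le>n. if cut_row j = i \<and> cut j \<le> u \<and> u < cut j + k
    then V (u - cut j) j else 0)" for i u
  \<comment> \<open>The link to row \<open>Suc i\<close> enters with its degree \<open>d\<close>
    entry, of sign plus, and the link to row \<open>i - 1\<close> with its constant entry
    -1.\<close>
  have entry: "s i (i * d + b) + E (Suc i) (i * d + b) - E i (i * d + b) = 0"
    if bi: "b < k + d" "i < m" for b i
  proof -
    let ?Z = "\<lambda>a j. (if a \<le> b \<and> b - a \<le> d then coeff (zigzag_mat $$ (i, j)) (b - a) else 0) * V a j"
    have "0 = (\<Sum>a<k. \<Sum>j<m + n. ?Z a j)"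
      using sylvester_right_kernel_index[OF zigzag_mat_carrier v bi] block_index_less[OF bi] Sv
      by (simp add: V_def)
    also have "\<dots> = (\<Sum>j<m + n. \<Sum>a<k. ?Z a j)" by (rule sum.swap)
    also have "\<dots> = (\<Sum>j<m + n. if j \<le> n
        then (if i = cut_row j \<and> cut_deg j \<le> b \<and> b < cut_deg j + k then V (b - cut_deg j) j else 0)
        else (if i + n + 1 = j \<and> d \<le> b then V (b - d) j else 0)
          - (if i + n = j \<and> b < k then V b j else 0))"
      (is "_ = (\<Sum>j<m + n. if j \<le> n then ?A j else ?B j - ?C j)")
    proof (intro sum.cong refl)
      fix j assume j: "j \<in> {..<m + n}"
      have one: "(\<Sum>a<k. (if a + l = b then 1 else 0) * V a j) =
          (if l \<le> b \<and> b < l + k then V (b - l) j else 0)" for l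
      proof -
        have "(\<Sum>a<k. (if a + l = b then 1 else 0) * V a j) =
            (\<Sum>a<k. if a = b - l then (if l \<le> b then V a j else 0) else 0)"
          by (intro sum.cong refl) auto
        then show ?thesis by auto
      qed
      have pull: "(\<Sum>a<k. if c then f a else 0) = (if c then \<Sum>a<k. f a else (0 :: 'a))" for c f
        by simp
      show "(\<Sum>a<k. ?Z a j) = (if j \<le> n then ?A j else ?B j - ?C j)"
      proof (cases "j \<le> n")
        case True
        have "(\<Sum>a<k. ?Z a j) =
            (\<Sum>a<k. if i = cut_row j then (if a + cut_deg j = b then 1 else 0) * V a j else 0)"
          using True j bi cut_deg_le[OF True]
          by (intro sum.cong refl) (auto simp: coeff_zigzag_mat)
        then show ?thesis using True one[of "cut_deg j"] by (cases "i = cut_row j") simp_all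
      next
        case False
        have "(\<Sum>a<k. ?Z a j) =
            (\<Sum>a<k. (if i + n + 1 = j then (if a + d = b then 1 else 0) * V a j else 0)
              - (if i + n = j then (if a + 0 = b then 1 else 0) * V a j else 0))"
          using False j bi d by (intro sum.cong refl) (auto simp: coeff_zigzag_mat)
        also have "\<dots> = ?B j - ?C j"
          unfolding sum_subtractf pull using one[of d] one[of 0] bi by simp
        finally show ?thesis using False by simp
      qed
    qed
    also have "\<dots> = (\<Sum>j\<le>n. ?A j) + (\<Sum>j\<in>{n<..<m + n}. ?B j - ?C j)"
    proof -
      have "{..<m + n} = {..n} \<union> {n<..<m + n}" using m by auto
      moreover have "{..n} \<inter> {n<..<m + n} = {}" by auto
      ultimately show ?thesis by (simp add: sum.union_disjoint)
    qed
    also have "(\<Sum>j\<le>n. ?A j) = s i (i * d + b)"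
      unfolding s_def using cut_eq by (intro sum.cong refl) auto
    \<comment> \<open>The range of column indices matches the bounds on the row index in
      \<open>E\<close>, which give 0 where a link is missing.\<close>
    also have "(\<Sum>j\<in>{n<..<m + n}. ?B j - ?C j) = E (Suc i) (i * d + b) - E i (i * d + b)"
    proof -
      have "(\<Sum>j\<in>{n<..<m + n}. ?B j) =
          (\<Sum>j\<in>{n<..<m + n}. if j = i + n + 1 then (if d \<le> b then V (b - d) j else 0) else 0)"
        by (intro sum.cong refl) auto
      also have "\<dots> = E (Suc i) (i * d + b)" using bi by (auto simp: E_def add_ac)
      finally have B: "(\<Sum>j\<in>{n<..<m + n}. ?B j) = E (Suc i) (i * d + b)" .
      have "(\<Sum>j\<in>{n<..<m + n}. ?C j) =
          (\<Sum>j\<in>{n<..<m + n}. if j = i + n then (if b < k then V b j else 0) else 0)"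
        by (intro sum.cong refl) auto
      also have "\<dots> = E i (i * d + b)" using bi by (auto simp: E_def add_ac)
      finally show ?thesis using B by (simp add: sum_subtractf)
    qed
    finally show ?thesis by (simp add: add_diff_eq)
  qed
  \<comment> \<open>Outside the positions of row \<open>i\<close> every term is 0, so the row
    equation extends to all \<open>u\<close> and can be summed over the rows.\<close>
  have diff: "s i u = E i u - E (Suc i) u" if "i < m" for i u
  proof (cases "i * d \<le> u \<and> u < i * d + d + k")
    case True
    then have "u - i * d < k + d" "i * d + (u - i * d) = u" by linarith+
    then show ?thesis using entry[of "u - i * d" i] that by (simp add: algebra_simps)
  next
    case False
    have "\<not> (cut_row j = i \<and> cut j \<le> u \<and> u < cut j + k)" if "j \<le> n" for j
      using False cut_eq[of j] cut_deg_le[OF that] by auto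
    then have "s i u = 0" unfolding s_def by (intro sum.neutral) auto
    moreover have "E i u = 0" "E (Suc i) u = 0" using False by (auto simp: E_def)
    ultimately show ?thesis by simp
  qed
  have Vcut: "V a j = 0" if aj: "a < k" "j \<le> n" for a j
  proof -
    let ?u = "cut j + a"
    have other: "\<not> (cut j' \<le> ?u \<and> ?u < cut j' + k)" if "j' \<noteq> j" for j'
      using cut_gap_le[OF tall, of j j'] cut_gap_le[OF tall, of j' j] that aj
      by (cases "j < j'") auto
    \<comment> \<open>The telescoping sum ends in the default values of \<open>E\<close>, and
      disjointness of the windows leaves only the cut \<open>j\<close>.\<close>
    have "0 = E 0 ?u - E m ?u" by (simp add: E_def)
    also have "\<dots> = (\<Sum>i<m. s i ?u)"
      using sum_lessThan_telescope'[of "\<lambda>i. E i ?u" m] diff by simp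
    also have "\<dots> = (\<Sum>j'\<le>n. \<Sum>i<m. if cut_row j' = i \<and> cut j' \<le> ?u \<and> ?u < cut j' + k
        then V (?u - cut j') j' else 0)"
      unfolding s_def by (rule sum.swap)
    also have "\<dots> = (\<Sum>j'\<le>n. \<Sum>i<m. if i = cut_row j' then (if j' = j then V a j else 0) else 0)"
      using other aj by (intro sum.cong refl) auto
    also have "\<dots> = V a j" using aj cut_row_less by simp
    finally show ?thesis by simp
  qed
  \<comment> \<open>With the cut columns gone, \<open>E i u\<close> is constant in \<open>i\<close>,
    and \<open>E 0 u = 0\<close>.\<close>
  have Ezero: "E i u = 0" if "i \<le> m" for i u
    using that
  proof (induction i)
    case (Suc i)
    have "s i u = 0" unfolding s_def by (intro sum.neutral) (auto simp: Vcut)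
    then show ?case using Suc diff[of i u] by simp
  qed (simp add: E_def)
  have "\<forall>c < k * (m + n). v $ c = 0" unfolding all_block_index
  proof (intro allI impI)
    fix a j assume aj: "a < k" "j < m + n"
    show "v $ (a * (m + n) + j) = 0"
    proof (cases "j \<le> n")
      case True
      then show ?thesis using Vcut aj by (simp add: V_def)
    next
      case False
      then obtain i where "j = n + i" "1 \<le> i" "i < m"
        using less_imp_add_positive[of n j] aj by auto
      then show ?thesis using Ezero[of i "i * d + a"] aj by (simp add: E_def V_def)
    qed
  qed
  then show "v = 0\<^sub>v (k * (m + n))" using v by (intro eq_vecI) auto
qed

text \<open>\<open>(k + d) * m \<le> k * (m + n)\<close> amounts to
  \<open>d * m \<le> k * n\<close>, so the two rank lemmas cover both shapes.\<close>

lemma full_Sylvester_rank_zigzag: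
  "full_Sylvester_rank m n d (zigzag_mat :: 'a::conjugatable_ordered_field poly mat)"
  unfolding full_Sylvester_rank_def
proof (intro allI impI)
  fix k :: nat
  show "vec_space.rank ((k + d) * m) (sylvester_mat m n d (zigzag_mat :: 'a poly mat) k)
      = min ((k + d) * m) (k * (m + n))"
  proof (cases "d * m \<le> k * n")
    case True
    then show ?thesis using rank_zigzag_wide[OF True]
      unfolding add_mult_distrib add_mult_distrib2 by simp
  next
    case False
    then show ?thesis using rank_zigzag_tall[of k]
      unfolding add_mult_distrib add_mult_distrib2 by simp
  qed
qed

end

section \<open>The complement as a zero set\<close>

text \<open>Failure for a single \<open>k\<close> already violates the condition, so the zero sets
  are to be united, which is what the product does.\<close>

definition sylvester_discriminant ::
    "nat \<Rightarrow> nat \<Rightarrow> nat \<Rightarrow> (nat \<Rightarrow> 'a::conjugatable_ordered_field) \<Rightarrow> 'a" where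
  "sylvester_discriminant m n d g = (\<Prod>k\<in>{1..d * m}. gram_det (sylvester_of m n d k g))"

lemma full_Sylvester_rank_iff_discriminant:
  fixes M :: "'a::conjugatable_ordered_field poly mat"
  assumes M: "M \<in> carrier_mat m (m + n)" and pos: "m > 0" "n > 0" "d > 0"
    and g: "\<And>s. s < (d + 1) * m * (m + n) \<Longrightarrow> g s = list_coeff m n M s"
  shows "full_Sylvester_rank m n d M \<longleftrightarrow> sylvester_discriminant m n d g \<noteq> 0"
  unfolding full_Sylvester_rank_iff_bounded[OF M pos] sylvester_discriminant_def
    rank_eq_min_iff_gram_det[OF sylvester_mat_carrier]
  using sylvester_mat_eq_sylvester_of[OF pos(1) g] by (auto simp: prod_zero_iff)

lemma (in conjugation_algebra) sylvester_discriminant: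
  assumes m: "m > 0" and g: "\<And>s. s < (d + 1) * m * (m + n) \<Longrightarrow> R (\<lambda>x. g x s)"
  shows "R (\<lambda>x. sylvester_discriminant m n d (g x))"
  unfolding sylvester_discriminant_def
proof (intro prod gram_det)
  fix k show "sylvester_of m n d k (g x) \<in> carrier_mat ((k + d) * m) (k * (m + n))" for x
    by simp
next
  fix k r c assume "r < (k + d) * m" "c < k * (m + n)"
  moreover have "((r div m - c div (m + n)) * m + r mod m) * (m + n) + c mod (m + n)
      < (d + 1) * m * (m + n)" if "r div m - c div (m + n) \<le> d"
    using that m by (intro list_coeff_index_less) auto
  ultimately show "R (\<lambda>x. sylvester_of m n d k (g x) $$ (r, c))"
    using g by (cases "c div (m + n) \<le> r div m \<and> r div m - c div (m + n) \<le> d")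
      (simp_all add: sylvester_of_def Let_def const del: de_Morgan_conj)
qed

section \<open>Transfer to the coordinate spaces\<close>

lemma Syl_subset: "Syl m n d \<subseteq> poly_mats m n d"
  by (auto simp: Syl_def)

lemma (in zigzag) Syl_nonempty: "(Syl m n d :: 'a::conjugatable_ordered_field poly mat set) \<noteq> {}"
proof -
  have "(zigzag_mat :: 'a poly mat) \<in> Syl m n d"
    by (simp add: Syl_def zigzag_mat_in_poly_mats full_Sylvester_rank_zigzag)
  then show ?thesis by (metis empty_iff)
qed

text \<open>The image of the complement is exactly a zero set and misses the image of any point of
  \<open>S\<close>; it then serves itself as the witness for genericity.\<close>

lemma proper_algebraic_generic:
  assumes bij: "bij_betw \<phi> X (carrier_vec p)" and "S \<subseteq> X" "S \<noteq> {}"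
    and alg: "algebraic_set p {x \<in> carrier_vec p. F x = 0}"
    and F: "\<And>M. M \<in> X \<Longrightarrow> M \<in> S \<longleftrightarrow> F (\<phi> M) \<noteq> 0"
  shows "proper_algebraic_set p (\<phi> ` (X - S)) \<and> generic_set p (\<phi> ` S)"
proof -
  have "\<phi> ` (X - S) = {x \<in> \<phi> ` X. F x = 0}"
    using F by blast
  also have "\<phi> ` X = carrier_vec p" by (rule bij_betw_imp_surj_on[OF bij])
  finally have "algebraic_set p (\<phi> ` (X - S))" using alg by simp
  moreover have diff: "\<phi> ` (X - S) = carrier_vec p - \<phi> ` S"
    using inj_on_image_set_diff[OF bij_betw_imp_inj_on[OF bij], of X S] \<open>S \<subseteq> X\<close>
      bij_betw_imp_surj_on[OF bij] by simp
  moreover have sub: "\<phi> ` S \<subseteq> carrier_vec p"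
    using bij_betw_imp_surj_on[OF bij] \<open>S \<subseteq> X\<close> by blast
  ultimately have "proper_algebraic_set p (\<phi> ` (X - S))"
    using \<open>S \<noteq> {}\<close> unfolding proper_algebraic_set_def by blast
  then show ?thesis unfolding generic_set_def using diff sub by auto
qed

theorem theorem5p1:
  fixes m n d :: nat
  assumes "m > 0" and "n > 0" and "d > 0"
  shows "(proper_algebraic_set ((d + 1) * m * (m + n))
            (real_coords m n d ` (poly_mats m n d - Syl m n d)) \<and>
          generic_set ((d + 1) * m * (m + n)) (real_coords m n d ` Syl m n d)) \<and>
         (proper_algebraic_set (2 * (d + 1) * m * (m + n))
            (complex_coords m n d ` (poly_mats m n d - Syl m n d)) \<and>
          generic_set (2 * (d + 1) * m * (m + n)) (complex_coords m n d ` Syl m n d))"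
proof (rule conjI)
  let ?F = "\<lambda>x :: real vec. sylvester_discriminant m n d (\<lambda>s. x $ s)"
  show "proper_algebraic_set ((d + 1) * m * (m + n))
            (real_coords m n d ` (poly_mats m n d - Syl m n d)) \<and>
          generic_set ((d + 1) * m * (m + n)) (real_coords m n d ` Syl m n d)"
  proof (rule proper_algebraic_generic[OF bij_betw_real_coords Syl_subset zigzag.Syl_nonempty])
    show "algebraic_set ((d + 1) * m * (m + n))
        {x \<in> carrier_vec ((d + 1) * m * (m + n)). ?F x = 0}"
      by (intro algebraic_set_zeros polynomial_fun_coord assms
          conjugation_algebra.sylvester_discriminant[OF conjugation_algebra_polynomial_fun])
    fix M :: "real poly mat" assume M: "M \<in> poly_mats m n d"
    have "full_Sylvester_rank m n d M \<longleftrightarrow> ?F (real_coords m n d M) \<noteq> 0"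
      by (rule full_Sylvester_rank_iff_discriminant)
        (use M assms in \<open>auto simp: poly_mats_def real_coords_def\<close>)
    then show "M \<in> Syl m n d \<longleftrightarrow> ?F (real_coords m n d M) \<noteq> 0" using M by (simp add: Syl_def)
  qed (use assms in \<open>simp_all add: zigzag_def\<close>)
  \<comment> \<open>Coordinates \<open>2 * s\<close> and \<open>2 * s + 1\<close> recombine to the
    complex coefficient with index \<open>s\<close>.\<close>
  let ?G = "\<lambda>x :: real vec. sylvester_discriminant m n d 
      (\<lambda>s. Complex (x $ (2 * s)) (x $ (2 * s + 1)))"
  show "proper_algebraic_set (2 * (d + 1) * m * (m + n))
            (complex_coords m n d ` (poly_mats m n d - Syl m n d)) \<and>
          generic_set (2 * (d + 1) * m * (m + n)) (complex_coords m n d ` Syl m n d)"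
  proof (rule proper_algebraic_generic[OF bij_betw_complex_coords Syl_subset zigzag.Syl_nonempty])
    have less: "2 * s < 2 * (d + 1) * m * (m + n)" "2 * s + 1 < 2 * (d + 1) * m * (m + n)"
      if "s < (d + 1) * m * (m + n)" for s
      using that unfolding mult.assoc by linarith+
    show "algebraic_set (2 * (d + 1) * m * (m + n))
        {x \<in> carrier_vec (2 * (d + 1) * m * (m + n)). ?G x = 0}"
    proof (intro algebraic_set_zeros_complex assms
          conjugation_algebra.sylvester_discriminant[OF conjugation_algebra_complex_polynomial_fun])
      fix s assume "s < (d + 1) * m * (m + n)"
      then show "complex_polynomial_fun (2 * (d + 1) * m * (m + n))
          (\<lambda>x. Complex (x $ (2 * s)) (x $ (2 * s + 1)))"
        unfolding complex_polynomial_fun_def complex.sel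
        by (intro conjI polynomial_fun_coord less)
    qed
    fix M :: "complex poly mat" assume M: "M \<in> poly_mats m n d"
    have "full_Sylvester_rank m n d M \<longleftrightarrow> ?G (complex_coords m n d M) \<noteq> 0"
    proof (rule full_Sylvester_rank_iff_discriminant)
      fix s assume "s < (d + 1) * m * (m + n)"
      then show "Complex (complex_coords m n d M $ (2 * s)) (complex_coords m n d M $ (2 * s + 1))
          = list_coeff m n M s"
        using less by (simp add: complex_coords_def del: mult_Suc add_Suc_right)
    qed (use M assms in \<open>auto simp: poly_mats_def\<close>)
    then show "M \<in> Syl m n d \<longleftrightarrow> ?G (complex_coords m n d M) \<noteq> 0" using M by (simp add: Syl_def)
  qed (use assms in \<open>simp_all add: zigzag_def\<close>)
qed

end
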